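(* Let $d(u_i,u_j)$ denote the minimal number of diagonal-flips needed to transform the triangulation of the convex $(n+2)$-gon corresponding to the generator $u_i$ of the Temperley-Lieb algebra $TL_n$ into the triangulation corresponding to the generator $u_j$. Let $1\le i\le n-1$ and let $k\ge 2$ be an integer. Then, whenever the indices of the generators involved lie in $\{1,\dots,n-1\}$, $$d(u_i,u_{i+1})=\begin{cases}3 & \text{if } i\ne n-2,\\ 2 & \text{if } i=n-2,\end{cases}\qquad d(u_i,u_{i+k})=\begin{cases}k+1 & \text{if } i\ne n-k-1,\\ k & \text{if } i=n-k-1,\end{cases}$$ $$d(u_i,u_{i-1})=\begin{cases}3 & \text{if } i\ne n-1,\\ 2 & \text{if } i=n-1,\end{cases}\qquad d(u_i,u_{i-k})=\begin{cases}k+1 & \text{if } i\ne n-1,\\ k & \text{if } i=n-1.\end{cases}$$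
   Context: Generators: $u_i$ ($1\le i\le n-1$) is identified with the following plane perfect matching on vertices $v_1,\dots,v_{2n}$, placed in two parallel rows of $n$ vertices, labeled in clockwise order with $v_1,\dots,v_n$ on top (left to right) and $v_{n+1},\dots,v_{2n}$ at the bottom (right to left, so that $v_{2n+1-j}$ lies below $v_j$): the edges are $v_iv_{i+1}$, $v_{2n-i}v_{2n-i+1}$, and $v_jv_{2n+1-j}$ for all $j\in\{1,\dots,n\}\setminus\{i,i+1\}$. Corresponding triangulation: direct every matching edge $v_av_b$, $a<b$, from $v_a$ to $v_b$, and let $B=(b_1,\dots,b_{2n})$ be the resulting 0/1 outdegree sequence. For a triangulation of a convex $(n+2)$-gon with points $p_1,\dots,p_{n+2}$ in clockwise order, direct edges from lower to higher index and let $D=(d_1,\dots,d_n)$, where $d_i$ is the outdegree of $p_i$ counting all diagonals and the boundary edge $p_1p_{n+2}$, but no other boundary edge. Both sequences determine their graph. The triangulation corresponding to a matching is the one for which $d_1$ is the number of 1s before the first 0 in $B$ and, for $2\le i\le n$, $d_i$ is the number of 1s between the $(i-1)$-st 0 and the $i$-th 0 of $B$. This is a bijection between plane perfect matchings on $2n$ vertices in convex position and triangulations of the convex $(n+2)$-gon. A diagonal-flip of a triangulation removes one diagonal and replaces it by the other diagonal of the convex quadrilateral formed by its two incident triangles. *)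

theory Defs
  imports Main "HOL-Library.Extended_Nat"
begin

text \<open>
  Geometric graphs on points in convex position, labelled 1, 2, \<dots> in clockwise order, are sets
  of pairs \<open>(a, b)\<close> with \<open>a < b\<close>; the pair is the edge directed from the lower to the higher label.
\<close>

type_synonym edge_set = "(nat \<times> nat) set"

definition outdeg :: "edge_set \<Rightarrow> nat \<Rightarrow> nat" where
  "outdeg E a = card {b. (a, b) \<in> E}"

text \<open>
  The matching on \<open>v\<^sub>1, \<dots>, v\<^sub>2\<^sub>n\<close> of the Temperley--Lieb generator \<open>u\<^sub>i\<close>, meaningful for
  \<open>1 \<le> i \<le> n - 1\<close>.
\<close>

definition generator :: "nat \<Rightarrow> nat \<Rightarrow> edge_set" where
  "generator n i =
     {(i, i + 1), (2 * n - i, 2 * n - i + 1)} \<union> {(j, 2 * n + 1 - j) | j. j \<in> {1..n} - {i, i + 1}}"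

text \<open>
  The number of 1s between the \<open>(i-1)\<close>-st and the \<open>i\<close>-th 0 (before the first 0 if \<open>i = 1\<close>) of the
  outdegree sequence of a matching on \<open>2n\<close> vertices: these are the 1s preceded by exactly \<open>i - 1\<close> 0s.
\<close>

definition ones_in_gap :: "nat \<Rightarrow> edge_set \<Rightarrow> nat \<Rightarrow> nat" where
  "ones_in_gap n M i =
     card {a \<in> {1..2 * n}. outdeg M a = 1 \<and> card {c \<in> {1..<a}. outdeg M c = 0} = i - 1}"

definition polygon_sides :: "nat \<Rightarrow> edge_set" where
  "polygon_sides m = {(a, a + 1) | a. 1 \<le> a \<and> a < m} \<union> {(1, m)}"

definition polygon_diagonals :: "nat \<Rightarrow> edge_set" where
  "polygon_diagonals m = {(a, b). 1 \<le> a \<and> a < b \<and> b \<le> m} - polygon_sides m"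

text \<open>Chords of points in convex position cross iff their endpoints alternate.\<close>

definition crossing :: "nat \<times> nat \<Rightarrow> nat \<times> nat \<Rightarrow> bool" where
  "crossing e f \<longleftrightarrow>
     fst e < fst f \<and> fst f < snd e \<and> snd e < snd f \<or>
     fst f < fst e \<and> fst e < snd f \<and> snd f < snd e"

text \<open>
  A triangulation is represented by its set of diagonals, a maximal set of pairwise noncrossing
  diagonals; the sides of the polygon are left implicit.
\<close>

definition triangulation :: "nat \<Rightarrow> edge_set \<Rightarrow> bool" where
  "triangulation m T \<longleftrightarrow>
     T \<subseteq> polygon_diagonals m \<and>
     (\<forall>e\<in>T. \<forall>f\<in>T. \<not> crossing e f) \<and>
     (\<forall>e\<in>polygon_diagonals m - T. \<exists>f\<in>T. crossing e f)"

definition corresponding_triangulation :: "nat \<Rightarrow> edge_set \<Rightarrow> edge_set" where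
  "corresponding_triangulation n M =
     (THE T. triangulation (n + 2) T \<and>
             (\<forall>i\<in>{1..n}. outdeg (T \<union> {(1, n + 2)}) i = ones_in_gap n M i))"

text \<open>
  Three points that are pairwise joined by diagonals or sides span a triangle of the triangulation.
  So, for \<open>p < q < r < s\<close>, if the four sides of the quadrilateral \<open>pqrs\<close> are present, then the
  quadrilateral is formed by the two triangles incident to whichever of its diagonals \<open>pr\<close> and \<open>qs\<close>
  is present.
\<close>

definition diagonal_flip :: "nat \<Rightarrow> edge_set \<Rightarrow> edge_set \<Rightarrow> bool" where
  "diagonal_flip m S T \<longleftrightarrow>
     (\<exists>p q r s. p < q \<and> q < r \<and> r < s \<and>
        {(p, q), (q, r), (r, s), (p, s)} \<subseteq> S \<union> polygon_sides m \<and>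
        ((p, r) \<in> S \<and> T = S - {(p, r)} \<union> {(q, s)} \<or>
         (q, s) \<in> S \<and> T = S - {(q, s)} \<union> {(p, r)}))"

text \<open>The value is \<open>\<infinity>\<close> if no sequence of flips leads from \<open>S\<close> to \<open>T\<close>.\<close>

definition flip_distance :: "nat \<Rightarrow> edge_set \<Rightarrow> edge_set \<Rightarrow> enat" where
  "flip_distance m S T = (INF l \<in> {l. (diagonal_flip m ^^ l) S T}. enat l)"

definition generator_distance :: "nat \<Rightarrow> nat \<Rightarrow> nat \<Rightarrow> enat" where
  "generator_distance n i j =
     flip_distance (n + 2)
       (corresponding_triangulation n (generator n i))
       (corresponding_triangulation n (generator n j))"

end

theory Submission
  imports Defs
begin

text \<open>
  Put \<open>c = n - i\<close>. The triangulation of \<open>u\<^sub>i\<close> arises from the one that joins point 1 to the points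
  \<open>c + 3, \<dots>, n + 2\<close> and point 2 to the points \<open>3, \<dots>, c + 3\<close> by flipping the diagonal
  \<open>(2, c + 2)\<close>, so that \<open>c + 2\<close> becomes an ear; for \<open>c = 1\<close> that chord is a side and nothing is
  flipped. A flip exchanges a single diagonal, hence the distance of two triangulations is at least
  the number of diagonals of one that are missing in the other. Explicit flip sequences in which
  each flip creates a diagonal of the target attain this bound.
\<close>

section \<open>Triangulations are determined by their outdegrees\<close>

text \<open>A diagonal crossing \<open>(a, b)\<close> either starts between \<open>a\<close> and
  \<open>b\<close> and ends beyond \<open>b\<close>, which \<open>visible\<close> excludes, or
  starts before \<open>a\<close> and ends between \<open>a\<close> and \<open>b\<close>, and then it
  also crosses \<open>(a, b')\<close>. Maximality puts \<open>(a, b)\<close> into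
  \<open>T\<close>.\<close>

lemma triangulation_out_edges_downward:
  assumes tri: "triangulation m T"
    and edge: "(a, b') \<in> T \<union> {(1, m)}"
    and b: "a + 2 \<le> b" "b < b'" "1 \<le> a"
    and visible: "\<And>x y. (x, y) \<in> T \<Longrightarrow> a < x \<Longrightarrow> x < b \<Longrightarrow> y \<le> b"
  shows "(a, b) \<in> T"
proof (rule ccontr)
  assume "(a, b) \<notin> T"
  moreover have "b' \<le> m"
    using edge tri by (auto simp: triangulation_def polygon_diagonals_def)
  then have "(a, b) \<in> polygon_diagonals m"
    using b by (auto simp: polygon_diagonals_def polygon_sides_def)
  ultimately obtain f where f: "f \<in> T" "crossing (a, b) f"
    using tri unfolding triangulation_def by blast
  obtain x y where xy: "f = (x, y)" by fastforce
  have "\<not> (a < x \<and> x < b \<and> b < y)"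
    using visible f xy by fastforce
  then have *: "x < a" "a < y" "y < b"
    using f(2) xy by (auto simp: crossing_def)
  \<comment> \<open>Since a point precedes \<open>a\<close>, the edge \<open>(a, b')\<close> is not
    the side \<open>(1, m)\<close> and must belong to \<open>T\<close>.\<close>
  have "1 \<le> x"
    using f(1) xy tri by (auto simp: triangulation_def polygon_diagonals_def)
  then have "(a, b') \<in> T" using * edge by auto
  then have "\<not> crossing (a, b') f" using tri f(1) by (auto simp: triangulation_def)
  then show False using * b xy by (auto simp: crossing_def)
qed

text \<open>Descending induction on the start point \<open>a\<close>. Once all edges starting beyond
  \<open>a\<close> agree, the out-neighbours of \<open>a\<close> in the two triangulations form
  nested sets; equal size makes them equal.\<close>

lemma triangulation_determined_by_outdegrees:
  assumes S: "triangulation m S" and T: "triangulation m T"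
    and deg: "\<forall>a\<in>{1..m - 2}. outdeg (S \<union> {(1, m)}) a = outdeg (T \<union> {(1, m)}) a"
  shows "S = T"
proof -
  define out where "out E a = {b. (a, b) \<in> E \<union> {(1, m)}}" for E :: edge_set and a
  have diag: "1 \<le> x \<and> x + 2 \<le> y \<and> y \<le> m" if "(x, y) \<in> S \<union> T" for x y
  proof -
    have "(x, y) \<in> polygon_diagonals m"
      using that S T by (auto simp: triangulation_def)
    then show ?thesis
      by (cases "y = x + 1") (auto simp: polygon_diagonals_def polygon_sides_def)
  qed
  have one_m: "(1, m) \<notin> S" "(1, m) \<notin> T"
    using S T by (auto simp: triangulation_def polygon_diagonals_def polygon_sides_def)
  have eq: "out S a = out T a" if "1 \<le> a" "a \<le> m - 2" for a
    using that
  proof (induction "m - a" arbitrary: a rule: less_induct)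
    case less
    have a: "a + 2 \<le> m" using less.prems by linarith
    have above: "(x, y) \<in> S \<longleftrightarrow> (x, y) \<in> T" if "a < x" for x y
    proof (cases "x \<le> m - 2")
      case True
      then have "out S x = out T x" using less that by auto
      then show ?thesis using that less.prems by (auto simp: out_def set_eq_iff)
    next
      case False
      then have "\<not> (x + 2 \<le> y \<and> y \<le> m)" by linarith
      then show ?thesis using diag by blast
    qed
    have span: "a + 2 \<le> b \<and> b \<le> m" if "b \<in> out S a \<union> out T a" for b
      using that diag a by (auto simp: out_def)
    have fin: "finite (out S a)" "finite (out T a)"
      by (rule finite_subset[of _ "{..m}"], use span in auto)+
    have card: "card (out S a) = card (out T a)"
      using deg less.prems by (auto simp: out_def outdeg_def)
    \<comment> \<open>Chords starting beyond \<open>a\<close> lie in both triangulations by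
      \<open>above\<close>, so they cross no edge out of \<open>a\<close>, whichever triangulation
      that edge comes from.\<close>
    have vis: "y \<le> b"
      if h: "b \<in> out S a \<union> out T a" "(x, y) \<in> S \<union> T" "a < x" "x < b" for b x y
    proof -
      have xy: "(x, y) \<in> S" "(x, y) \<in> T" using above h by auto
      consider "(a, b) \<in> S" | "(a, b) \<in> T" | "b = m" using h(1) by (auto simp: out_def)
      then show ?thesis
      proof cases
        case 1
        then have "\<not> crossing (a, b) (x, y)" using xy S by (auto simp: triangulation_def)
        then show ?thesis using h by (auto simp: crossing_def)
      next
        case 2
        then have "\<not> crossing (a, b) (x, y)" using xy T by (auto simp: triangulation_def)
        then show ?thesis using h by (auto simp: crossing_def)
      next
        case 3
        then show ?thesis using diag[OF h(2)] by simp
      qed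
    qed
    have down_T: "b \<in> out T a" if "b \<in> out S a" "b' \<in> out T a" "b < b'" for b b'
    proof -
      have "(a, b) \<in> T"
        by (rule triangulation_out_edges_downward[OF T, of a b'])
          (use that span vis less.prems in \<open>auto simp: out_def\<close>)
      then show ?thesis by (simp add: out_def)
    qed
    have down_S: "b \<in> out S a" if "b \<in> out T a" "b' \<in> out S a" "b < b'" for b b'
    proof -
      have "(a, b) \<in> S"
        by (rule triangulation_out_edges_downward[OF S, of a b'])
          (use that span vis less.prems in \<open>auto simp: out_def\<close>)
      then show ?thesis by (simp add: out_def)
    qed
    \<comment> \<open>An element of one set missing from the other exceeds all elements of the
      other, which are therefore contained in the first.\<close>
    have "out S a \<subseteq> out T a \<or> out T a \<subseteq> out S a"
      using down_S down_T by (metis subsetI linorder_neqE_nat)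
    then show ?case using card fin by (metis card_subset_eq)
  qed
  have "(x, y) \<in> S \<longleftrightarrow> (x, y) \<in> T" for x y
  proof (cases "1 \<le> x \<and> x \<le> m - 2")
    case True
    then have "y \<in> out S x \<longleftrightarrow> y \<in> out T x" using eq by simp
    then show ?thesis using one_m by (auto simp: out_def)
  next
    case False
    then have "\<not> (1 \<le> x \<and> x + 2 \<le> y \<and> y \<le> m)" by linarith
    then show ?thesis using diag by blast
  qed
  then show ?thesis by auto
qed

section \<open>The triangulations of the generators\<close>

text \<open>Only diagonals are stored, so the ranges omit the sides \<open>(1, n + 2)\<close> and
  \<open>(2, 3)\<close> of the two fans.\<close>

definition double_fan :: "nat \<Rightarrow> nat \<Rightarrow> edge_set" where
  "double_fan n c =
     {(1, b) | b. c + 3 \<le> b \<and> b \<le> n + 1} \<union> {(2, b) | b. 4 \<le> b \<and> b \<le> c + 3}"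

text \<open>For \<open>c = 1\<close> the exclusion of \<open>c + 2\<close> is vacuous and
  \<open>(c + 1, c + 3)\<close> is \<open>(2, 4)\<close>, already in the fan at 2, so this case
  needs no separate clause.\<close>

definition ear_fan :: "nat \<Rightarrow> nat \<Rightarrow> edge_set" where
  "ear_fan n c =
     {(1, b) | b. c + 3 \<le> b \<and> b \<le> n + 1} \<union>
     {(2, b) | b. 4 \<le> b \<and> b \<le> c + 3 \<and> b \<noteq> c + 2} \<union> {(c + 1, c + 3)}"

lemma ear_fan_1: "ear_fan n 1 = double_fan n 1"
  by (auto simp: ear_fan_def double_fan_def)

lemma triangulation_ear_fan:
  assumes "1 \<le> c" "c < n"
  shows "triangulation (n + 2) (ear_fan n c)"
  unfolding triangulation_def
proof (intro conjI ballI)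
  show "ear_fan n c \<subseteq> polygon_diagonals (n + 2)"
    using assms by (auto simp: ear_fan_def polygon_diagonals_def polygon_sides_def)
next
  fix e f assume "e \<in> ear_fan n c" "f \<in> ear_fan n c"
  then show "\<not> crossing e f"
    using assms by (auto simp: ear_fan_def crossing_def)
next
  fix e assume e: "e \<in> polygon_diagonals (n + 2) - ear_fan n c"
  obtain a b where ab: "e = (a, b)" by fastforce
  have "1 \<le> a" "b \<le> n + 2" "b \<noteq> a + 1" "a < b" "\<not> (a = 1 \<and> b = n + 2)"
    using e ab by (auto simp: polygon_diagonals_def polygon_sides_def)
  then have d: "1 \<le> a" "a + 2 \<le> b" "b \<le> n + 2" "\<not> (a = 1 \<and> b = n + 2)"
    by auto
  have nin: "(a, b) \<notin> ear_fan n c" using e ab by auto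
  \<comment> \<open>A chord starting at \<open>a \<ge> 3\<close> is crossed by the fan diagonal
    ending at \<open>a + 1\<close>. Only for \<open>a = c + 1\<close> is that diagonal,
    \<open>(2, c + 2)\<close>, missing, and \<open>(2, c + 3)\<close> takes its place.\<close>
  consider "a = 1" | "a = 2" "b = c + 2" | "a = 2" "b \<ge> c + 4"
    | "a \<ge> 3" "a \<le> c + 2" "a \<noteq> c + 1" | "a \<ge> 3" "a = c + 1" "b > c + 3" | "a \<ge> c + 3"
  proof -
    have "a = 2 \<Longrightarrow> b = c + 2 \<or> b \<ge> c + 4" "a = c + 1 \<Longrightarrow> b \<noteq> c + 3"
      using d nin by (auto simp: ear_fan_def)
    then show ?thesis using that d(1,2) by linarith
  qed
  then show "\<exists>f\<in>ear_fan n c. crossing e f"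
  proof cases
    case 1
    then have "b < c + 3" using nin d by (auto simp: ear_fan_def)
    then show ?thesis
      using 1 d assms ab by (intro bexI[of _ "(2, c + 3)"]) (auto simp: ear_fan_def crossing_def)
  next
    case 2
    then show ?thesis
      using d assms ab by (intro bexI[of _ "(c + 1, c + 3)"]) (auto simp: ear_fan_def crossing_def)
  next
    case 3
    then show ?thesis
      using d assms ab by (intro bexI[of _ "(1, c + 3)"]) (auto simp: ear_fan_def crossing_def)
  next
    case 4
    then show ?thesis
      using d assms ab by (intro bexI[of _ "(2, a + 1)"]) (auto simp: ear_fan_def crossing_def)
  next
    case 5
    then show ?thesis
      using d assms ab by (intro bexI[of _ "(2, c + 3)"]) (auto simp: ear_fan_def crossing_def)
  next
    case 6
    then show ?thesis
      using d assms ab by (intro bexI[of _ "(1, a + 1)"]) (auto simp: ear_fan_def crossing_def)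
  qed
qed

text \<open>The \<open>max\<close> covers \<open>c = 1\<close>, where \<open>c - 1\<close> is 0 but
  \<open>(2, 4)\<close> still starts at point 2.\<close>

lemma outdeg_ear_fan:
  assumes "1 \<le> c" "c < n" "1 \<le> a"
  shows "outdeg (ear_fan n c \<union> {(1, n + 2)}) a =
    (if a = 1 then n - c else if a = 2 then max 1 (c - 1) else if a = c + 1 then 1 else 0)"
proof -
  let ?N = "{b. (a, b) \<in> ear_fan n c \<union> {(1, n + 2)}}"
  consider "a = 1" | "a = 2" "c = 1" | "a = 2" "c \<ge> 2" | "a > 2" "a = c + 1" | "a > 2" "a \<noteq> c + 1"
    using assms by linarith
  then show ?thesis
  proof cases
    case 1
    then have "?N = {c + 3..n + 2}" using assms by (auto simp: ear_fan_def)
    then show ?thesis using 1 by (simp add: outdeg_def)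
  next
    case 2
    then have "?N = {4}" by (auto simp: ear_fan_def)
    then show ?thesis using 2 by (simp add: outdeg_def)
  next
    case 3
    then have "?N = {4..c + 3} - {c + 2}" by (auto simp: ear_fan_def)
    moreover have "card ({4..c + 3} - {c + 2}) = c - 1"
      using 3 by (subst card_Diff_singleton) auto
    ultimately show ?thesis using 3 by (simp add: outdeg_def)
  next
    case 4
    then have "?N = {c + 3}" by (auto simp: ear_fan_def)
    then show ?thesis using 4 by (simp add: outdeg_def)
  next
    case 5
    then have "?N = {}" by (auto simp: ear_fan_def)
    then show ?thesis using 5 by (simp add: outdeg_def)
  qed
qed

section \<open>Outdegree sequences of the generators\<close>

lemma outdeg_generator:
  assumes "1 \<le> i" "i < n"
  shows "outdeg (generator n i) a = (if a \<in> {1..n} - {i + 1} \<union> {2 * n - i} then 1 else 0)"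
proof -
  let ?N = "{b. (a, b) \<in> generator n i}"
  consider "a = i" | "a = 2 * n - i" | "a \<in> {1..n} - {i, i + 1}"
    | "a \<notin> {1..n} - {i + 1} \<union> {2 * n - i}" "a \<noteq> i"
    by blast
  then show ?thesis
  proof cases
    case 1
    then have "?N = {i + 1}" using assms by (auto simp: generator_def)
    then show ?thesis using 1 assms by (simp add: outdeg_def)
  next
    case 2
    then have "?N = {2 * n - i + 1}" using assms by (auto simp: generator_def)
    then show ?thesis using 2 assms by (simp add: outdeg_def)
  next
    case 3
    then have "?N = {2 * n + 1 - a}" using assms by (auto simp: generator_def)
    then show ?thesis using 3 assms by (simp add: outdeg_def)
  next
    case 4
    then have "?N = {}" using assms by (auto simp: generator_def)
    then show ?thesis using 4 by (simp add: outdeg_def)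
  qed
qed

text \<open>The outdegree sequence consists of \<open>i\<close> ones, a zero,
  \<open>n - i - 1\<close> ones, \<open>n - i - 1\<close> zeros, a single one at
  \<open>2 * n - i\<close>, and \<open>i\<close> zeros. For \<open>i = n - 1\<close> the single one
  falls into the second gap, whence the \<open>max\<close>.\<close>

lemma ones_in_gap_generator:
  assumes "1 \<le> i" "i < n" "1 \<le> a"
  shows "ones_in_gap n (generator n i) a =
    (if a = 1 then i else if a = 2 then max 1 (n - i - 1) else if a = n - i + 1 then 1 else 0)"
proof -
  define zeros where "zeros v = card {w \<in> {1..<v}. outdeg (generator n i) w = 0}" for v
  have zeros_low: "zeros v = 0" if "v \<le> i" for v
  proof -
    have "{w \<in> {1..<v}. outdeg (generator n i) w = 0} = {}"
      using that assms by (auto simp: outdeg_generator)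
    then show ?thesis by (simp add: zeros_def)
  qed
  have zeros_mid: "zeros v = 1" if "i + 2 \<le> v" "v \<le> n" for v
  proof -
    have "{w \<in> {1..<v}. outdeg (generator n i) w = 0} = {i + 1}"
      using that assms by (auto simp: outdeg_generator)
    then show ?thesis by (simp add: zeros_def)
  qed
  have zeros_high: "zeros (2 * n - i) = n - i"
  proof -
    have "{w \<in> {1..<2 * n - i}. outdeg (generator n i) w = 0} = insert (i + 1) {n + 1..<2 * n - i}"
      using assms by (auto simp: outdeg_generator)
    then show ?thesis using assms by (simp add: zeros_def)
  qed
  have "{v \<in> {1..2 * n}. outdeg (generator n i) v = 1 \<and> zeros v = a - 1} =
      {v \<in> {1..i} \<union> {i + 2..n} \<union> {2 * n - i}. zeros v = a - 1}"
    using assms by (auto simp: outdeg_generator)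
  also have "\<dots> = (if a = 1 then {1..i} else {}) \<union> (if a = 2 then {i + 2..n} else {}) \<union>
      (if a = n - i + 1 then {2 * n - i} else {})"
    using assms by (auto simp: zeros_low zeros_mid zeros_high)
  finally have "ones_in_gap n (generator n i) a =
      card ((if a = 1 then {1..i} else {}) \<union> (if a = 2 then {i + 2..n} else {}) \<union>
      (if a = n - i + 1 then {2 * n - i} else {}))"
    by (simp add: ones_in_gap_def zeros_def)
  then show ?thesis using assms by auto
qed

lemma corresponding_triangulation_generator:
  assumes "1 \<le> i" "i < n"
  shows "corresponding_triangulation n (generator n i) = ear_fan n (n - i)"
  unfolding corresponding_triangulation_def
proof (rule the_equality)
  have c: "1 \<le> n - i" "n - i < n" using assms by auto
  have "outdeg (ear_fan n (n - i) \<union> {(1, n + 2)}) a = ones_in_gap n (generator n i) a"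
    if "1 \<le> a" for a
    unfolding outdeg_ear_fan[OF c that] ones_in_gap_generator[OF assms that] using assms by simp
  then show *: "triangulation (n + 2) (ear_fan n (n - i)) \<and>
      (\<forall>a\<in>{1..n}. outdeg (ear_fan n (n - i) \<union> {(1, n + 2)}) a = ones_in_gap n (generator n i) a)"
    using triangulation_ear_fan[OF c] by auto
  show "T = ear_fan n (n - i)" if "triangulation (n + 2) T \<and>
      (\<forall>a\<in>{1..n}. outdeg (T \<union> {(1, n + 2)}) a = ones_in_gap n (generator n i) a)" for T
    using that * by (intro triangulation_determined_by_outdegrees[of "n + 2"]) auto
qed

section \<open>Flip distances\<close>

text \<open>Each flip enlarges either difference by at most one element. Both differences are
  bounded so that one count of missing diagonals serves both directions.\<close>

lemma card_diff_le_flips: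
  assumes "(diagonal_flip m ^^ l) S T"
  shows "finite (S - T) \<and> card (S - T) \<le> l \<and> finite (T - S) \<and> card (T - S) \<le> l"
  using assms
proof (induction l arbitrary: T)
  case 0
  then show ?case by simp
next
  case (Suc l)
  then obtain U where U: "(diagonal_flip m ^^ l) S U" "diagonal_flip m U T" by auto
  note IH = Suc.IH[OF U(1)]
  obtain e f where "T = U - {e} \<union> {f}"
    using U(2) unfolding diagonal_flip_def by blast
  then have sub: "S - T \<subseteq> insert e (S - U)" "T - S \<subseteq> insert f (U - S)" by auto
  have "card (insert e (S - U)) \<le> Suc l" "card (insert f (U - S)) \<le> Suc l"
    using IH by (auto simp: card_insert_if)
  then show ?case
    using sub IH by (meson card_mono finite_insert finite_subset le_trans)
qed

lemma flip_distance_eqI: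
  assumes "(diagonal_flip m ^^ l) S T"
    and "\<And>l'. (diagonal_flip m ^^ l') S T \<Longrightarrow> l \<le> l'"
  shows "flip_distance m S T = enat l"
  unfolding flip_distance_def
  using assms by (intro antisym INF_lower INF_greatest) auto

text \<open>Recording both directions lets a single path give the upper bound for
  \<open>d(u_i, u_j)\<close> and for \<open>d(u_j, u_i)\<close>.\<close>

definition reversible_flip :: "nat \<Rightarrow> edge_set \<Rightarrow> edge_set \<Rightarrow> bool" where
  "reversible_flip m S T \<longleftrightarrow> diagonal_flip m S T \<and> diagonal_flip m T S"

text \<open>The sides of the quadrilateral survive the flip, and \<open>(q, s) \<notin> S\<close>
  ensures that flipping back restores \<open>S\<close>.\<close>

lemma reversible_flipI:
  assumes "p < q" "q < r" "r < s"
    and "{(p, q), (q, r), (r, s), (p, s)} \<subseteq> S \<union> polygon_sides m"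
    and "(p, r) \<in> S" "(q, s) \<notin> S" "T = S - {(p, r)} \<union> {(q, s)}"
  shows "reversible_flip m S T"
proof -
  have "diagonal_flip m S T"
    unfolding diagonal_flip_def using assms by blast
  moreover have "{(p, q), (q, r), (r, s), (p, s)} \<subseteq> T \<union> polygon_sides m"
    using assms by auto
  moreover have "(q, s) \<in> T" "S = T - {(q, s)} \<union> {(p, r)}"
    using assms by auto
  ultimately show ?thesis
    unfolding reversible_flip_def diagonal_flip_def using assms(1-3) by blast
qed

lemma reversible_flips:
  assumes "(reversible_flip m ^^ l) S T"
  shows "(diagonal_flip m ^^ l) S T" "(diagonal_flip m ^^ l) T S"
proof -
  show "(diagonal_flip m ^^ l) S T"
    using assms by (rule relpowp_mono[rotated]) (simp add: reversible_flip_def)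
  show "(diagonal_flip m ^^ l) T S"
    using assms
  proof (induction l arbitrary: T)
    case 0
    then show ?case by simp
  next
    case (Suc l)
    then obtain U where U: "(reversible_flip m ^^ l) S U" "reversible_flip m U T" by auto
    then have "diagonal_flip m T U" by (simp add: reversible_flip_def)
    then show ?case using Suc.IH[OF U(1)] by (rule relpowp_Suc_I2)
  qed
qed

section \<open>Explicit flip sequences\<close>

lemma flip_double_fan_ear_fan:
  assumes "2 \<le> c" "c < n"
  shows "reversible_flip (n + 2) (double_fan n c) (ear_fan n c)"
  by (rule reversible_flipI[of 2 "c + 1" "c + 2" "c + 3"])
    (use assms in \<open>auto simp: double_fan_def ear_fan_def polygon_sides_def\<close>)

lemma flip_double_fan_Suc:
  assumes "1 \<le> c" "Suc c < n"
  shows "reversible_flip (n + 2) (double_fan n c) (double_fan n (Suc c))"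
  by (rule reversible_flipI[of 1 2 "c + 3" "c + 4"])
    (use assms in \<open>auto simp: double_fan_def polygon_sides_def\<close>)

lemma flips_double_fan_add:
  assumes "1 \<le> c" "c + j < n"
  shows "(reversible_flip (n + 2) ^^ j) (double_fan n c) (double_fan n (c + j))"
  using assms
proof (induction j)
  case 0
  then show ?case by simp
next
  case (Suc j)
  then show ?case
    using flip_double_fan_Suc[of "c + j" n] by (auto intro!: relpowp_Suc_I)
qed

text \<open>Moving the fan boundary twice and then cutting the ear would take three flips. Cutting
  the ear at \<open>c + 4\<close> first saves one, as \<open>(2, c + 4)\<close> is never
  created.\<close>

lemma flips_double_fan_ear_fan_add_2:
  assumes "1 \<le> c" "c + 2 < n"
  shows "(reversible_flip (n + 2) ^^ 2) (double_fan n c) (ear_fan n (c + 2))"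
proof -
  let ?U = "double_fan n c - {(1, c + 4)} \<union> {(c + 3, c + 5)}"
  have "reversible_flip (n + 2) (double_fan n c) ?U"
    by (rule reversible_flipI[of 1 "c + 3" "c + 4" "c + 5"])
      (use assms in \<open>auto simp: double_fan_def polygon_sides_def\<close>)
  moreover have "reversible_flip (n + 2) ?U (ear_fan n (c + 2))"
    by (rule reversible_flipI[of 1 2 "c + 3" "c + 5"])
      (use assms in \<open>auto simp: double_fan_def ear_fan_def polygon_sides_def\<close>)
  ultimately show ?thesis by (auto simp: numeral_2_eq_2)
qed

text \<open>For \<open>k \<ge> 2\<close> the fan boundary moves \<open>k - 2\<close> times before
  the two-flip shortcut. For \<open>k = 1\<close> the shortcut does not fit: one move and one ear
  flip give 2, hence \<open>max k 2\<close>.\<close>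

lemma flips_double_fan_ear_fan:
  assumes "1 \<le> c" "c + k < n" "1 \<le> k"
  shows "(reversible_flip (n + 2) ^^ max k 2) (double_fan n c) (ear_fan n (c + k))"
proof (cases "k = 1")
  case True
  then show ?thesis
    using assms flip_double_fan_Suc[of c n] flip_double_fan_ear_fan[of "Suc c" n]
    by (auto simp: numeral_2_eq_2)
next
  case False
  define j where "j = k - 2"
  have k: "k = j + 2" using False assms by (simp add: j_def)
  have "(reversible_flip (n + 2) ^^ j) (double_fan n c) (double_fan n (c + j))"
    using assms k by (intro flips_double_fan_add) auto
  moreover have "(reversible_flip (n + 2) ^^ 2) (double_fan n (c + j)) (ear_fan n (c + j + 2))"
    using assms k by (intro flips_double_fan_ear_fan_add_2) auto
  ultimately have "(reversible_flip (n + 2) ^^ (j + 2)) (double_fan n c) (ear_fan n (c + j + 2))"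
    unfolding relpowp_add by (rule relcomppI)
  then show ?thesis using k by (simp add: add.assoc)
qed

text \<open>The extra flip for \<open>c \<noteq> 1\<close> undoes the ear at the start.\<close>

lemma flips_ear_fan:
  assumes "1 \<le> c" "c + k < n" "1 \<le> k"
  shows "(reversible_flip (n + 2) ^^ (max k 2 + (if c = 1 then 0 else 1)))
    (ear_fan n c) (ear_fan n (c + k))"
proof (cases "c = 1")
  case True
  then show ?thesis using flips_double_fan_ear_fan[OF assms] by (simp add: ear_fan_1[simplified])
next
  case False
  then have "reversible_flip (n + 2) (ear_fan n c) (double_fan n c)"
    using flip_double_fan_ear_fan[of c n] assms by (simp add: reversible_flip_def)
  then show ?thesis
    using relpowp_Suc_I2[OF _ flips_double_fan_ear_fan[OF assms]] False by simp
qed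

section \<open>Counting missing diagonals and the resulting distances\<close>

text \<open>Missing from the target are the \<open>k\<close> diagonals at point 1 that the fan at 2
  takes over (\<open>A\<close>), the old ear diagonal unless \<open>c = 1\<close>
  (\<open>C\<close>), and, if \<open>k = 1\<close>, also \<open>(2, c + 3)\<close>, which the new
  ear cuts off (\<open>B\<close>).\<close>

lemma card_ear_fan_diff:
  assumes "1 \<le> c" "c + k < n" "1 \<le> k"
  shows "max k 2 + (if c = 1 then 0 else 1) \<le> card (ear_fan n c - ear_fan n (c + k))"
proof -
  define A B C :: edge_set where "A = Pair 1 ` {c + 3..c + k + 2}"
    and "B = (if k = 1 then {(2, c + 3)} else {})"
    and "C = (if c = 1 then {} else {(c + 1, c + 3)})"
  have "ear_fan n c \<subseteq> {..n + 2} \<times> {..n + 2}"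
    using assms by (auto simp: ear_fan_def)
  then have "finite (ear_fan n c)"
    by (rule finite_subset) simp
  moreover have "A \<subseteq> ear_fan n c - ear_fan n (c + k)"
    using assms by (auto simp: A_def ear_fan_def)
  moreover have "B \<subseteq> ear_fan n c - ear_fan n (c + k)"
    using assms by (auto simp: B_def ear_fan_def)
  moreover have "C \<subseteq> ear_fan n c - ear_fan n (c + k)"
    using assms by (auto simp: C_def ear_fan_def)
  ultimately have "card (A \<union> B \<union> C) \<le> card (ear_fan n c - ear_fan n (c + k))"
    by (intro card_mono) auto
  moreover have "finite A" "finite B" "finite C"
    by (simp_all add: A_def B_def C_def)
  moreover have "A \<inter> B = {}" "(A \<union> B) \<inter> C = {}"
    using assms(1) by (auto simp: A_def B_def C_def split: if_splits)
  ultimately have "card A + card B + card C \<le> card (ear_fan n c - ear_fan n (c + k))"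
    by (simp add: card_Un_disjoint)
  moreover have "card A = k"
    by (simp add: A_def card_image inj_on_def)
  moreover have "card B = (if k = 1 then 1 else 0)" "card C = (if c = 1 then 0 else 1)"
    by (simp_all add: B_def C_def)
  ultimately show ?thesis using assms(3) by (simp split: if_splits)
qed

lemma generator_distance_add:
  assumes "1 \<le> i" "i + k < n" "1 \<le> k"
  defines "d \<equiv> max k 2 + (if i + k = n - 1 then 0 else 1)"
  shows "generator_distance n i (i + k) = enat d" "generator_distance n (i + k) i = enat d"
proof -
  \<comment> \<open>The larger index has the smaller parameter: the path from \<open>c\<close> to
    \<open>c + k\<close> leads from \<open>u_(i+k)\<close> to \<open>u_i\<close>, and
    \<open>i + k = n - 1\<close> means \<open>c = 1\<close>.\<close>
  define c where "c = n - (i + k)"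
  have c: "1 \<le> c" "c + k < n" "n - i = c + k" "d = max k 2 + (if c = 1 then 0 else 1)"
    using assms by (auto simp: c_def)
  have tri: "corresponding_triangulation n (generator n i) = ear_fan n (c + k)"
      "corresponding_triangulation n (generator n (i + k)) = ear_fan n c"
    using corresponding_triangulation_generator[of i n]
      corresponding_triangulation_generator[of "i + k" n, folded c_def] assms(1,2) c(3)
    by simp_all
  note flips = reversible_flips[OF flips_ear_fan[OF c(1,2) assms(3)], folded c(4)]
  note diff = card_ear_fan_diff[OF c(1,2) assms(3), folded c(4)]
  show "generator_distance n i (i + k) = enat d"
    unfolding generator_distance_def tri
    by (rule flip_distance_eqI) (fact flips(2), use diff card_diff_le_flips le_trans in blast)
  show "generator_distance n (i + k) i = enat d"
    unfolding generator_distance_def tri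
    by (rule flip_distance_eqI) (fact flips(1), use diff card_diff_le_flips le_trans in blast)
qed

theorem proposition15:
  fixes n i k :: nat
  assumes "1 \<le> i" and "i \<le> n - 1" and "k \<ge> 2"
  shows "(i + 1 \<in> {1..n - 1} \<longrightarrow>
            generator_distance n i (i + 1) = (if i \<noteq> n - 2 then 3 else 2)) \<and>
         (i + k \<in> {1..n - 1} \<longrightarrow>
            generator_distance n i (i + k) = (if i \<noteq> n - k - 1 then enat (k + 1) else enat k)) \<and>
         (i - 1 \<in> {1..n - 1} \<longrightarrow>
            generator_distance n i (i - 1) = (if i \<noteq> n - 1 then 3 else 2)) \<and>
         (i - k \<in> {1..n - 1} \<longrightarrow>
            generator_distance n i (i - k) = (if i \<noteq> n - 1 then enat (k + 1) else enat k))"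
proof (intro conjI impI)
  assume "i + 1 \<in> {1..n - 1}"
  then show "generator_distance n i (i + 1) = (if i \<noteq> n - 2 then 3 else 2)"
    using generator_distance_add(1)[of i 1 n] assms by (auto simp: numeral_eq_enat)
next
  assume "i + k \<in> {1..n - 1}"
  then show "generator_distance n i (i + k) = (if i \<noteq> n - k - 1 then enat (k + 1) else enat k)"
    using generator_distance_add(1)[of i k n] assms by auto
next
  \<comment> \<open>Membership rules out truncated subtraction, so \<open>i\<close> is the larger
    index of a pair starting at \<open>i - 1\<close>, and the reversed distance applies.\<close>
  assume "i - 1 \<in> {1..n - 1}"
  then show "generator_distance n i (i - 1) = (if i \<noteq> n - 1 then 3 else 2)"
    using generator_distance_add(2)[of "i - 1" 1 n] assms by (auto simp: numeral_eq_enat)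
next
  assume "i - k \<in> {1..n - 1}"
  then show "generator_distance n i (i - k) = (if i \<noteq> n - 1 then enat (k + 1) else enat k)"
    using generator_distance_add(2)[of "i - k" k n] assms by auto
qed

end
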